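(* Let $\mathbb{K}$ be a field of characteristic zero, let $d\geq 2$ be a prime power, and let ${\bf n}=(n_1,\ldots,n_{d-1})$ be a $(d-1)$-tuple of integers with $n_i\geq 1$. In the $(d-1)$-dimensional linear space $H=\{({\bf a},b)\in\mathbb{K}^{d-1}\times\mathbb{K}:\bar{\bf a}=0\}$ let $V_i^{\bf 0,n}$ be the locus defined by the vanishing of the polynomial function $f_i({\bf a},b)=a_i-F_{{\bf a},b}^{n_i}(a_i)$, for $1\leq i\leq d-1$, and let $V^{\bf 0,n}=\bigcap_{i=1}^{d-1}V_i^{\bf 0,n}$. Then $V^{\bf 0,n}$ consists entirely of simple points (that is, at every point of $V^{\bf 0,n}$ the differentials of $f_1|_H,\ldots,f_{d-1}|_H$ are linearly independent): near any point of their common intersection, the loci $V_i^{\bf 0,n}$ are smooth, reduced hypersurfaces in $H$ which are pairwise transverse.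
   Context: For ${\bf a}=(a_1,\ldots,a_{d-1})\in\mathbb{K}^{d-1}$ and $b\in\mathbb{K}$, let $\sigma_k$ be the $k$-th elementary symmetric function of $a_1,\ldots,a_{d-1}$, let $\bar{\bf a}=\frac{1}{d-1}\sum_{i=1}^{d-1}a_i$, and define $$F_{{\bf a},b}(z)=z^d+\sum_{k=1}^{d-1}(-1)^{d-k}\frac{d}{k}\sigma_{d-k}z^k+b-\bar{\bf a}^d-\sum_{k=1}^{d-1}(-1)^{d-k}\frac{d}{k}\sigma_{d-k}\bar{\bf a}^k .$$ This is the unique monic polynomial of degree $d$ whose critical points, listed with multiplicity, are $a_1,\ldots,a_{d-1}$ and which satisfies $F_{{\bf a},b}(\bar{\bf a})=b$. Iterates are defined by $F^0(z)=z$ and $F^{n+1}(z)=F(F^n(z))$. The locus $V_i^{\bf 0,n}$ is taken with the scheme structure given by the equation $f_i|_H=0$; it is smooth and reduced at a point where $f_i|_H$ vanishes if the differential of $f_i|_H$ is nonzero there, and two such hypersurfaces are transverse at a common point if the corresponding differentials are linearly independent there. *)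

theory Defs
  imports
    Complex_Main
    "HOL-Library.FuncSet"
    "HOL-Library.Poly_Mapping"
    "HOL-Number_Theory.Prime_Powers"
begin

text \<open>Monomials are finitely supported exponent vectors, and the multiplication of
  \<^typ>\<open>(nat \<Rightarrow>\<^sub>0 nat) \<Rightarrow>\<^sub>0 'a\<close> is the convolution product.\<close>

type_synonym 'a mpoly = "(nat \<Rightarrow>\<^sub>0 nat) \<Rightarrow>\<^sub>0 'a"

definition mconst :: "'a::comm_ring_1 \<Rightarrow> 'a mpoly" where
  "mconst c = Poly_Mapping.single 0 c"

definition mvar :: "nat \<Rightarrow> 'a::comm_ring_1 mpoly" where
  "mvar j = Poly_Mapping.single (Poly_Mapping.single j 1) 1"

definition meval :: "'a::comm_ring_1 mpoly \<Rightarrow> (nat \<Rightarrow> 'a) \<Rightarrow> 'a" where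
  "meval P x = (\<Sum>m\<in>Poly_Mapping.keys P.
     Poly_Mapping.lookup P m * (\<Prod>j\<in>Poly_Mapping.keys m. x j ^ Poly_Mapping.lookup m j))"

definition mpderiv :: "nat \<Rightarrow> 'a::comm_ring_1 mpoly \<Rightarrow> 'a mpoly" where
  "mpderiv j P = (\<Sum>m\<in>Poly_Mapping.keys P.
     Poly_Mapping.single (m - Poly_Mapping.single j 1)
       (of_nat (Poly_Mapping.lookup m j) * Poly_Mapping.lookup P m))"

definition esym :: "nat \<Rightarrow> nat \<Rightarrow> (nat \<Rightarrow> 'r::comm_ring_1) \<Rightarrow> 'r" where
  "esym N k a = (\<Sum>S | S \<subseteq> {1..N} \<and> card S = k. \<Prod>i\<in>S. a i)"

text \<open>The scalars are mapped into the coefficient ring by \<open>\<iota>\<close>. With \<open>\<iota> = id\<close> the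
  parameters are elements of the field itself; with \<open>\<iota> = mconst\<close> they may be
  indeterminates.\<close>

definition amean :: "('a::field_char_0 \<Rightarrow> 'r::comm_ring_1) \<Rightarrow> nat \<Rightarrow> (nat \<Rightarrow> 'r) \<Rightarrow> 'r" where
  "amean \<iota> d a = \<iota> (1 / of_nat (d - 1)) * (\<Sum>i=1..d - 1. a i)"

definition critF ::
  "('a::field_char_0 \<Rightarrow> 'r::comm_ring_1) \<Rightarrow> nat \<Rightarrow> (nat \<Rightarrow> 'r) \<Rightarrow> 'r \<Rightarrow> 'r \<Rightarrow> 'r" where
  "critF \<iota> d a b z =
     z ^ d
     + (\<Sum>k=1..d - 1. (-1) ^ (d - k) * \<iota> (of_nat d / of_nat k) * esym (d - 1) (d - k) a * z ^ k)
     + b - amean \<iota> d a ^ d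
     - (\<Sum>k=1..d - 1. (-1) ^ (d - k) * \<iota> (of_nat d / of_nat k) * esym (d - 1) (d - k) a
          * amean \<iota> d a ^ k)"

definition orbit_eq ::
  "('a::field_char_0 \<Rightarrow> 'r::comm_ring_1) \<Rightarrow> nat \<Rightarrow> nat \<Rightarrow> nat \<Rightarrow> (nat \<Rightarrow> 'r) \<Rightarrow> 'r \<Rightarrow> 'r" where
  "orbit_eq \<iota> d m i a b = a i - (critF \<iota> d a b ^^ m) (a i)"

text \<open>The first component of a point is an extensional function on \<open>{1..d - 1}\<close>.\<close>

type_synonym 'a pt = "(nat \<Rightarrow> 'a) \<times> 'a"

definition H :: "nat \<Rightarrow> 'a::field_char_0 pt set" where
  "H d = {(a, b). a \<in> {1..d - 1} \<rightarrow>\<^sub>E UNIV \<and> amean id d a = 0}"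

definition V :: "nat \<Rightarrow> (nat \<Rightarrow> nat) \<Rightarrow> nat \<Rightarrow> 'a::field_char_0 pt set" where
  "V d n i = {(a, b). (a, b) \<in> H d \<and> orbit_eq id d (n i) i a b = 0}"

definition Vall :: "nat \<Rightarrow> (nat \<Rightarrow> nat) \<Rightarrow> 'a::field_char_0 pt set" where
  "Vall d n = (\<Inter>i\<in>{1..d - 1}. V d n i)"

text \<open>Variable \<open>0\<close> stands for \<open>b\<close>, variable \<open>j\<close> with \<open>1 \<le> j \<le> d - 1\<close> for the \<open>j\<close>-th entry
  of \<open>a\<close>. On \<open>H d\<close> the coordinates with index at least \<open>d\<close> are constant.\<close>

definition coord :: "'a pt \<Rightarrow> nat \<Rightarrow> 'a" where
  "coord x = (fst x)(0 := snd x)"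

definition fpoly :: "nat \<Rightarrow> (nat \<Rightarrow> nat) \<Rightarrow> nat \<Rightarrow> 'a::field_char_0 mpoly" where
  "fpoly d n i = orbit_eq mconst d (n i) i mvar (mvar 0)"

definition differential :: "nat \<Rightarrow> 'a::field_char_0 mpoly \<Rightarrow> 'a pt \<Rightarrow> 'a pt \<Rightarrow> 'a" where
  "differential d P x v = (\<Sum>j<d. meval (mpderiv j P) (coord x) * coord v j)"

text \<open>Linear independence of the family \<open>L i\<close>, \<open>i \<in> I\<close> (\<open>I\<close> finite), of linear forms
  restricted to \<open>H d\<close>; in a differential, \<open>H d\<close> plays the role of its own tangent space.\<close>

definition indep_on_H :: "nat \<Rightarrow> nat set \<Rightarrow> (nat \<Rightarrow> 'a::field_char_0 pt \<Rightarrow> 'a) \<Rightarrow> bool" where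
  "indep_on_H d I L \<longleftrightarrow>
     (\<forall>c. (\<forall>v\<in>H d. (\<Sum>i\<in>I. c i * L i v) = 0) \<longrightarrow> (\<forall>i\<in>I. c i = 0))"

definition basic_open :: "nat \<Rightarrow> 'a::field_char_0 mpoly \<Rightarrow> 'a pt set" where
  "basic_open d g = {x \<in> H d. meval g (coord x) \<noteq> 0}"

lemma meval_superset:
  assumes "finite A" "Poly_Mapping.keys P \<subseteq> A"
  shows "meval P x = (\<Sum>m\<in>A.
     Poly_Mapping.lookup P m * (\<Prod>j\<in>Poly_Mapping.keys m. x j ^ Poly_Mapping.lookup m j))"
  unfolding meval_def
  by (rule sum.mono_neutral_left) (use assms in \<open>auto simp: in_keys_iff\<close>)

lemma meval_add: "meval (P + Q) x = meval P x + meval Q x"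
proof -
  let ?A = "Poly_Mapping.keys P \<union> Poly_Mapping.keys Q"
  show ?thesis
    by (simp add: meval_superset[of ?A] Poly_Mapping.keys_add lookup_add sum.distrib
        distrib_right)
qed

lemma meval_0 [simp]: "meval 0 x = 0"
  by (simp add: meval_def)

lemma meval_sum: "meval (sum P I) x = (\<Sum>i\<in>I. meval (P i) x)"
  by (induction I rule: infinite_finite_induct) (simp_all add: meval_add)

lemma meval_uminus: "meval (- P) x = - meval P x"
  using meval_add[of P "- P" x] by (simp add: eq_neg_iff_add_eq_0 add.commute)

lemma meval_diff: "meval (P - Q) x = meval P x - meval Q x"
  using meval_add[of P "- Q" x] by (simp add: meval_uminus)

lemma meval_single:
  "meval (Poly_Mapping.single m c) x =
     c * (\<Prod>j\<in>Poly_Mapping.keys m. x j ^ Poly_Mapping.lookup m j)"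
  by (simp add: meval_def)

lemma monom_superset:
  fixes m :: "nat \<Rightarrow>\<^sub>0 nat" and x :: "nat \<Rightarrow> 'a::comm_ring_1"
  assumes "finite A" "Poly_Mapping.keys m \<subseteq> A"
  shows "(\<Prod>j\<in>Poly_Mapping.keys m. x j ^ Poly_Mapping.lookup m j) =
     (\<Prod>j\<in>A. x j ^ Poly_Mapping.lookup m j)"
  by (rule prod.mono_neutral_left) (use assms in \<open>auto simp: in_keys_iff\<close>)

lemma monom_add:
  fixes m m' :: "nat \<Rightarrow>\<^sub>0 nat" and x :: "nat \<Rightarrow> 'a::comm_ring_1"
  shows "(\<Prod>j\<in>Poly_Mapping.keys (m + m'). x j ^ Poly_Mapping.lookup (m + m') j) =
     (\<Prod>j\<in>Poly_Mapping.keys m. x j ^ Poly_Mapping.lookup m j) *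
     (\<Prod>j\<in>Poly_Mapping.keys m'. x j ^ Poly_Mapping.lookup m' j)"
proof -
  let ?A = "Poly_Mapping.keys m \<union> Poly_Mapping.keys m'"
  have "Poly_Mapping.keys (m + m') \<subseteq> ?A"
    by (rule Poly_Mapping.keys_add)
  then show ?thesis
    by (subst (1 2 3) monom_superset[of ?A]) (simp_all add: lookup_add power_add prod.distrib)
qed

lemma mpoly_sum_single:
  fixes P :: "'a::comm_ring_1 mpoly"
  shows "P = (\<Sum>m\<in>Poly_Mapping.keys P. Poly_Mapping.single m (Poly_Mapping.lookup P m))"
  by (rule poly_mapping_eqI)
     (simp add: lookup_sum lookup_single when_def in_keys_iff)

lemma meval_mult: "meval (P * Q) x = meval P x * meval Q x"
proof -
  let ?s = "\<lambda>R m. Poly_Mapping.single m (Poly_Mapping.lookup R m)"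
  have "P * Q = (\<Sum>m\<in>Poly_Mapping.keys P. ?s P m) * (\<Sum>m\<in>Poly_Mapping.keys Q. ?s Q m)"
    using mpoly_sum_single[of P] mpoly_sum_single[of Q] by simp
  also have "\<dots> = (\<Sum>m\<in>Poly_Mapping.keys P. \<Sum>m'\<in>Poly_Mapping.keys Q.
      Poly_Mapping.single (m + m') (Poly_Mapping.lookup P m * Poly_Mapping.lookup Q m'))"
    by (simp add: sum_product mult_single)
  finally show ?thesis
    by (simp add: meval_sum meval_single monom_add) (simp add: meval_def sum_product mult_ac)
qed

lemma meval_mconst [simp]: "meval (mconst c) x = c"
  by (simp add: mconst_def meval_single)

lemma meval_mvar [simp]: "meval (mvar j) x = x j"
  by (simp add: mvar_def meval_single)

lemma meval_1 [simp]: "meval 1 x = 1"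
  using meval_mconst[of 1 x] by (simp add: mconst_def)

lemma meval_power: "meval (P ^ k) x = meval P x ^ k"
  by (induction k) (simp_all add: meval_mult)

lemma meval_prod: "meval (prod P I) x = (\<Prod>i\<in>I. meval (P i) x)"
  by (induction I rule: infinite_finite_induct) (simp_all add: meval_mult)

lemmas meval_hom = meval_add meval_diff meval_uminus meval_mult meval_power meval_sum meval_prod

lemma meval_critF:
  "meval (critF mconst d a b z) x =
     critF id d (\<lambda>i. meval (a i) x) (meval b x) (meval z x)"
  by (simp add: critF_def amean_def esym_def meval_hom)

lemma critF_cong:
  assumes "\<And>i. i \<in> {1..d - 1} \<Longrightarrow> a i = a' i"
  shows "critF \<iota> d a b = critF \<iota> d a' b"
proof -
  have "esym (d - 1) k a = esym (d - 1) k a'" for k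
    unfolding esym_def by (intro sum.cong prod.cong refl assms) auto
  moreover have "amean \<iota> d a = amean \<iota> d a'"
    unfolding amean_def using assms by simp
  ultimately show ?thesis by (simp add: critF_def fun_eq_iff)
qed

lemma meval_fpoly:
  assumes "i \<in> {1..d - 1}"
  shows "meval (fpoly d n i) (coord (a, b)) = orbit_eq id d (n i) i a b"
proof -
  have it: "meval ((critF mconst d mvar (mvar 0) ^^ m) z) x =
      (critF id d x (x 0) ^^ m) (meval z x)" for m z and x :: "nat \<Rightarrow> 'a"
    by (induction m) (simp_all add: meval_critF id_def)
  have "critF id d (coord (a, b)) b = critF id d a b"
    by (rule critF_cong) (auto simp: coord_def)
  with assms show ?thesis
    by (simp add: fpoly_def orbit_eq_def meval_diff it) (simp add: coord_def)
qed

end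

theory Submission
  imports
    Defs
    "HOL-Computational_Algebra.Polynomial"
    "Jordan_Normal_Form.Determinant"
begin

text \<open>The proof is a reduction modulo the prime \<open>p\<close> of which \<open>d\<close> is a power. As \<open>d/k\<close> is divisible by \<open>p\<close>
  for \<open>0 < k < d\<close>, the polynomial \<open>F\<close> on the slice of mean zero is congruent to \<open>z ^ d + b\<close>. The
  derivative of \<open>z ^ d\<close> vanishes modulo \<open>p\<close>, so an iterate of \<open>F\<close> has differential \<open>db\<close> modulo \<open>p\<close>, and
  the differential of \<open>f\<^sub>i\<close> is congruent to \<open>da\<^sub>i - db\<close>. On \<open>H\<close>, where the \<open>da\<^sub>i\<close> sum to zero, these forms
  are independent because \<open>d - 1\<close> is prime to \<open>p\<close>, and independence modulo the maximal ideal implies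
  independence over the field.

  To reduce modulo \<open>p\<close> in a field of characteristic zero one needs a valuation ring of residue
  characteristic \<open>p\<close>, which a Zorn argument supplies in every such field
  (\<open>exists_residue_char_valuation_ring\<close>), and one needs the point to have coordinates in that ring
  (\<open>periodic_critical_points_integral\<close>). The latter is a non-archimedean escape argument: if the
  parameters were not integral, boundedness of the critical orbits would make all critical points
  congruent after rescaling, hence congruent to zero since their sum is zero, and then all parameters
  would be smaller than the largest of them.

  Independence near the point costs nothing more. It is the non-vanishing of one determinant
  (\<open>jacobian\<close>), a polynomial in the coordinates, so it persists on a principal open set, on which the
  differentials are nonzero and pairwise independent.\<close>

section \<open>Valuation rings of prescribed residue characteristic\<close>

definition subring_set :: "'a::comm_ring_1 set \<Rightarrow> bool" where
  "subring_set R \<longleftrightarrow> 1 \<in> R \<and> (\<forall>x\<in>R. \<forall>y\<in>R. x - y \<in> R \<and> x * y \<in> R)"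

lemma subring_setD:
  assumes "subring_set R"
  shows "1 \<in> R" "x \<in> R \<Longrightarrow> y \<in> R \<Longrightarrow> x - y \<in> R" "x \<in> R \<Longrightarrow> y \<in> R \<Longrightarrow> x * y \<in> R"
    "0 \<in> R" "x \<in> R \<Longrightarrow> - x \<in> R" "x \<in> R \<Longrightarrow> y \<in> R \<Longrightarrow> x + y \<in> R"
proof -
  show 1: "1 \<in> R" and d: "x \<in> R \<Longrightarrow> y \<in> R \<Longrightarrow> x - y \<in> R"
    and "x \<in> R \<Longrightarrow> y \<in> R \<Longrightarrow> x * y \<in> R" for x y
    using assms by (auto simp: subring_set_def)
  show 0: "0 \<in> R" using d[OF 1 1] by simp
  show m: "x \<in> R \<Longrightarrow> - x \<in> R" for x using d[OF 0] by simp
  show "x \<in> R \<Longrightarrow> y \<in> R \<Longrightarrow> x + y \<in> R" using d[of x "- y"] m by simp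
qed

lemma subring_set_sum:
  "subring_set R \<Longrightarrow> (\<And>i. i \<in> I \<Longrightarrow> f i \<in> R) \<Longrightarrow> sum f I \<in> R"
  by (induction I rule: infinite_finite_induct) (auto intro: subring_setD)

locale valuation_ring =
  fixes R :: "'a::field set"
  assumes subring_set: "subring_set R"
    and total_mem: "x \<in> R \<or> inverse x \<in> R"

text \<open>Since \<open>p\<close> lies in \<open>R\<close> and is not invertible there, it lies in the maximal ideal: the residue
  field of \<open>R\<close> has characteristic \<open>p\<close>.\<close>

locale residue_char_valuation_ring = valuation_ring R for R :: "'a::field_char_0 set" +
  fixes p :: nat
  assumes prime_p: "prime p" and inverse_p_notin: "inverse (of_nat p) \<notin> R"

definition adjoin :: "'a::comm_ring_1 set \<Rightarrow> 'a \<Rightarrow> 'a set" where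
  "adjoin R x = {poly f x | f. \<forall>i. coeff f i \<in> R}"

lemma subring_set_adjoin:
  assumes R: "subring_set R"
  shows "subring_set (adjoin R x)"
  unfolding subring_set_def
proof (intro conjI ballI)
  show "1 \<in> adjoin R x"
    unfolding adjoin_def
    by (rule CollectI, rule exI[of _ 1]) (auto simp: coeff_1 subring_setD[OF R])
next
  fix u v assume "u \<in> adjoin R x" "v \<in> adjoin R x"
  then obtain f g where uv: "u = poly f x" "v = poly g x"
    and fg: "\<And>i. coeff f i \<in> R" "\<And>i. coeff g i \<in> R"
    by (auto simp: adjoin_def)
  show "u - v \<in> adjoin R x"
    unfolding adjoin_def
    by (rule CollectI, rule exI[of _ "f - g"]) (auto simp: uv fg subring_setD[OF R])
  show "u * v \<in> adjoin R x"
    unfolding adjoin_def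
    by (rule CollectI, rule exI[of _ "f * g"])
       (auto simp: uv fg coeff_mult intro!: subring_set_sum[OF R] subring_setD(3)[OF R])
qed

lemma subset_adjoin:
  assumes "subring_set R"
  shows "R \<subseteq> adjoin R x"
proof
  fix r assume "r \<in> R"
  then show "r \<in> adjoin R x"
    unfolding adjoin_def
    by (intro CollectI exI[of _ "[:r:]"]) (auto simp: coeff_pCons subring_setD[OF assms] split: nat.split)
qed

lemma mem_adjoin:
  assumes "subring_set R"
  shows "x \<in> adjoin R x"
  unfolding adjoin_def
  by (intro CollectI exI[of _ "[:0, 1:]"])
     (auto simp: coeff_pCons subring_setD[OF assms] split: nat.split)

text \<open>Multiplying the relation for \<open>inverse x\<close> by \<open>x ^ degree f\<close> and dividing by the unit
  \<open>1 - q * coeff g 0\<close> writes \<open>x ^ degree f\<close> as a combination of lower powers of \<open>x\<close>; substituting this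
  for the leading power in \<open>f\<close> lowers the degree. So \<open>1\<close> cannot be in the ideals generated by \<open>q\<close> both
  in \<open>R[x]\<close> and in \<open>R[1/x]\<close>.\<close>

lemma lower_degree_relation:
  fixes q x :: "'a::field"
  assumes R: "subring_set R" and q: "q \<in> R" and unit: "\<And>s. s \<in> R \<Longrightarrow> inverse (1 - q * s) \<in> R"
    and nz: "\<And>s. s \<in> R \<Longrightarrow> 1 - q * s \<noteq> 0" and x: "x \<noteq> 0"
    and f: "\<And>i. coeff f i \<in> R" "q * poly f x = 1"
    and g: "\<And>i. coeff g i \<in> R" "q * poly g (inverse x) = 1"
    and le: "degree g \<le> degree f"
  shows "\<exists>f'. (\<forall>i. coeff f' i \<in> R) \<and> q * poly f' x = 1 \<and> degree f' < degree f"
proof -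
  define m n where "m = degree g" and "n = degree f"
  \<comment> \<open>\<open>G\<close> is \<open>x ^ m * (g - g(0))(1/x)\<close>, a polynomial of degree less than \<open>m\<close> in \<open>x\<close>.\<close>
  define G where "G = reflect_poly g - monom (coeff g 0) m"
  define u where "u = inverse (1 - q * coeff g 0)"
  define h where "h = smult (q * u) (monom 1 (n - m) * G)"
  define f' where "f' = f - monom (coeff f n) n + smult (coeff f n) h"
  note R_intros = subring_setD[OF R]
  have mn: "m \<le> n" using le by (simp add: m_def n_def)
  have npos: "n > 0"
  proof (rule ccontr)
    assume "\<not> n > 0"
    then have "degree g = 0" using mn by (simp add: m_def)
    then obtain c where "g = [:c:]" by (metis degree_eq_zeroE)
    then have "q * coeff g 0 = 1" using g(2) by simp
    then show False using nz[OF g(1)[of 0]] by simp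
  qed
  have GR: "coeff G i \<in> R" for i
    by (auto simp: G_def coeff_reflect_poly intro!: R_intros g)
  have G0: "coeff G i = 0" if "i \<ge> m" for i
    using that by (auto simp: G_def coeff_reflect_poly m_def)
  have uR: "u \<in> R" unfolding u_def by (rule unit[OF g(1)])
  have hR: "coeff h i \<in> R" for i
    by (auto simp: h_def coeff_monom_mult intro!: R_intros GR uR q)
  have h0: "coeff h i = 0" if "i \<ge> n" for i
    using that mn by (auto simp: h_def coeff_monom_mult G0)
  have "q * poly (reflect_poly g) x = x ^ m"
    using g(2) by (simp add: poly_reflect_poly_nz[OF x] m_def)
  then have "q * poly G x = (1 - q * coeff g 0) * x ^ m"
    by (simp add: G_def poly_monom algebra_simps)
  then have "u * (q * poly G x) = x ^ m"
    using nz[OF g(1)[of 0]] by (simp add: u_def)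
  then have "poly h x = x ^ (n - m) * x ^ m"
    by (simp add: h_def poly_monom mult_ac)
  then have hx: "poly h x = x ^ n"
    using mn by (simp flip: power_add)
  have "coeff f' i = 0" if "i > n - 1" for i
  proof (cases "i = n")
    case True then show ?thesis by (simp add: f'_def h0)
  next
    case False
    then have "i > n" using that by simp
    then show ?thesis by (simp add: f'_def h0 n_def coeff_eq_0)
  qed
  then have "degree f' \<le> n - 1" by (intro degree_le) auto
  moreover have "\<forall>i. coeff f' i \<in> R"
    by (auto simp: f'_def intro!: R_intros f hR)
  moreover have "poly f' x = poly f x"
    by (simp add: f'_def poly_monom hx)
  ultimately show ?thesis using npos f(2) by (intro exI[of _ f']) (auto simp: n_def)
qed

text \<open>A subring that is maximal among those not containing \<open>1/p\<close> is a valuation ring. Adjoining an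
  element \<open>x\<close> outside \<open>R\<close> produces \<open>1/p\<close>, that is a relation \<open>1 = p * f(x)\<close> with \<open>f\<close> over \<open>R\<close>; if the
  same happens for \<open>1/x\<close>, two relations of minimal degree contradict each other by the degree reduction
  above.\<close>

lemma exists_residue_char_valuation_ring:
  assumes p: "prime p"
  shows "\<exists>R :: 'a::field_char_0 set. residue_char_valuation_ring R p"
proof -
  define q :: 'a where "q = of_nat p"
  have q0: "q \<noteq> 0" using p by (auto simp: q_def)
  define \<A> where "\<A> = {R :: 'a set. subring_set R \<and> inverse q \<notin> R}"
  have "\<int> \<in> \<A>"
  proof -
    have "inverse q \<notin> \<int>"
    proof
      assume "inverse q \<in> \<int>"
      then obtain z where "inverse q = of_int z" by (auto elim: Ints_cases)
      then have "of_int (int p * z) = (1 :: 'a)" using q0 by (simp add: q_def field_simps)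
      then have "int p * z = 1" by (simp only: of_int_eq_1_iff)
      then show False using p by (auto simp: zmult_eq_1_iff)
    qed
    then show ?thesis by (auto simp: \<A>_def subring_set_def)
  qed
  then have ne: "\<A> \<noteq> {}" by blast
  have chain: "\<Union>C \<in> \<A>" if "C \<noteq> {}" "subset.chain \<A> C" for C
  proof -
    have C: "R \<in> \<A>" if "R \<in> C" for R using that \<open>subset.chain \<A> C\<close> by (auto simp: subset_chain_def)
    have "subring_set (\<Union>C)"
      unfolding subring_set_def
    proof (intro conjI ballI)
      show "1 \<in> \<Union>C" using C \<open>C \<noteq> {}\<close> by (auto simp: \<A>_def subring_set_def)
      fix x y assume "x \<in> \<Union>C" "y \<in> \<Union>C"
      then obtain R S where RS: "R \<in> C" "S \<in> C" "x \<in> R" "y \<in> S" by blast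
      then have "R \<subseteq> S \<or> S \<subseteq> R"
        using \<open>subset.chain \<A> C\<close> by (auto simp: subset_chain_def)
      then obtain B where "B \<in> C" "x \<in> B" "y \<in> B" using RS by blast
      then show "x - y \<in> \<Union>C" "x * y \<in> \<Union>C" using C[of B] by (auto simp: \<A>_def subring_set_def)
    qed
    then show ?thesis using C by (auto simp: \<A>_def)
  qed
  obtain R where RA: "R \<in> \<A>" and max: "\<And>S. S \<in> \<A> \<Longrightarrow> R \<subseteq> S \<Longrightarrow> S = R"
    using subset_Zorn_nonempty[OF ne chain] by blast
  have R: "subring_set R" and qR: "inverse q \<notin> R" using RA by (auto simp: \<A>_def)
  note R_intros = subring_setD[OF R]
  have "of_nat k \<in> R" for k by (induction k) (auto intro: R_intros)
  then have q: "q \<in> R" by (simp add: q_def)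
  have nz: "1 - q * s \<noteq> 0" if "s \<in> R" for s
  proof
    assume "1 - q * s = 0"
    then have "inverse q = s" using q0 by (simp add: field_simps)
    then show False using qR that by simp
  qed
  \<comment> \<open>Localising \<open>R\<close> at the elements \<open>1 - q * t\<close> does not create \<open>1/q\<close>, so it does not enlarge \<open>R\<close>.\<close>
  have unit: "inverse (1 - q * s) \<in> R" if s: "s \<in> R" for s
  proof -
    define S where "S = {r / (1 - q * t) | r t. r \<in> R \<and> t \<in> R}"
    have SI: "y \<in> S" if "r \<in> R" "t \<in> R" "y * (1 - q * t) = r" for y r t
    proof -
      have "y = r / (1 - q * t)" using that nz[of t] by (simp add: nonzero_eq_divide_eq)
      then show ?thesis using that unfolding S_def by blast
    qed
    have "subring_set S"
      unfolding subring_set_def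
    proof (intro conjI ballI)
      show "1 \<in> S" by (rule SI[of 1 0]) (auto intro: R_intros)
      fix x y assume "x \<in> S" "y \<in> S"
      then obtain r t r' t' where x: "x = r / (1 - q * t)" and y: "y = r' / (1 - q * t')"
        and m: "r \<in> R" "t \<in> R" "r' \<in> R" "t' \<in> R"
        by (auto simp: S_def)
      have den: "(1 - q * t) * (1 - q * t') = 1 - q * (t + t' - q * t * t')"
        by (simp add: algebra_simps)
      have nzs: "1 - q * t \<noteq> 0" "1 - q * t' \<noteq> 0" using m nz by auto
      have t_in: "t + t' - q * t * t' \<in> R" using m q by (intro R_intros)
      show "x - y \<in> S"
      proof (rule SI)
        show "r * (1 - q * t') - r' * (1 - q * t) \<in> R"
          using m q by (intro R_intros)
        show "(x - y) * (1 - q * (t + t' - q * t * t')) = r * (1 - q * t') - r' * (1 - q * t)"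
          unfolding den[symmetric] x y diff_frac_eq[OF nzs] using nzs by simp
      qed (rule t_in)
      show "x * y \<in> S"
      proof (rule SI)
        show "r * r' \<in> R" using m by (intro R_intros)
        show "x * y * (1 - q * (t + t' - q * t * t')) = r * r'"
          unfolding den[symmetric] x y using nzs by simp
      qed (rule t_in)
    qed
    moreover have "inverse q \<notin> S"
    proof
      assume "inverse q \<in> S"
      then obtain r t where rt: "r \<in> R" "t \<in> R" "inverse q = r / (1 - q * t)"
        by (auto simp: S_def)
      then have "inverse q = r + t" using nz[OF rt(2)] q0 by (simp add: field_simps)
      then show False using qR rt by (auto intro: R_intros)
    qed
    ultimately have "S \<in> \<A>" by (simp add: \<A>_def)
    moreover have "R \<subseteq> S" by (auto intro!: SI[of _ 0] R_intros)
    ultimately have "S = R" by (rule max)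
    moreover have "inverse (1 - q * s) \<in> S"
      by (rule SI[of 1 s]) (use s nz[OF s] in \<open>auto intro: R_intros\<close>)
    ultimately show ?thesis by simp
  qed
  have relation: "\<exists>f. (\<forall>i. coeff f i \<in> R) \<and> q * poly f x = 1" if "x \<notin> R" for x
  proof -
    have "adjoin R x \<noteq> R" using mem_adjoin[OF R, of x] that by blast
    then have "adjoin R x \<notin> \<A>" using max[of "adjoin R x"] subset_adjoin[OF R] by blast
    then have "inverse q \<in> adjoin R x" using subring_set_adjoin[OF R] by (simp add: \<A>_def)
    then obtain f where "inverse q = poly f x" "\<forall>i. coeff f i \<in> R" by (auto simp: adjoin_def)
    then show ?thesis using q0 by (metis right_inverse)
  qed
  have total: "x \<in> R \<or> inverse x \<in> R" for x
  proof (rule ccontr)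
    assume neg: "\<not> (x \<in> R \<or> inverse x \<in> R)"
    then have x0: "x \<noteq> 0" using R_intros(4) by auto
    define rel where "rel y f \<longleftrightarrow> (\<forall>i. coeff f i \<in> R) \<and> q * poly f y = 1" for y f
    have ex: "\<exists>f. rel x f" "\<exists>f. rel (inverse x) f"
      using relation[of x] relation[of "inverse x"] neg by (auto simp: rel_def)
    obtain f where f: "rel x f" "\<And>f'. rel x f' \<Longrightarrow> degree f \<le> degree f'"
      using ex_has_least_nat[of "rel x" _ degree] ex(1) by blast
    obtain g where g: "rel (inverse x) g" "\<And>g'. rel (inverse x) g' \<Longrightarrow> degree g \<le> degree g'"
      using ex_has_least_nat[of "rel (inverse x)" _ degree] ex(2) by blast
    show False
    proof (cases "degree g \<le> degree f")
      case True
      then show False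
        using lower_degree_relation[OF R q unit nz x0, of f g] f g by (force simp: rel_def)
    next
      case False
      then show False
        using lower_degree_relation[OF R q unit nz, of "inverse x" g f] x0 f g
        by (force simp: rel_def)
    qed
  qed
  have "residue_char_valuation_ring R p"
    by unfold_locales (use R total p qR in \<open>auto simp: q_def\<close>)
  then show ?thesis by blast
qed

section \<open>The order of a valuation\<close>

context valuation_ring
begin

lemma one_mem: "1 \<in> R"
  and mult_mem: "x \<in> R \<Longrightarrow> y \<in> R \<Longrightarrow> x * y \<in> R"
  using subring_setD[OF subring_set] by auto

text \<open>The valuation is kept as the divisibility preorder of \<open>R\<close> on the field: \<open>x \<preceq> y\<close> says that the
  absolute value of \<open>x\<close> is at most that of \<open>y\<close>. The elements \<open>x \<preceq> 1\<close> form \<open>R\<close>, the elements \<open>x \<prec> 1\<close> its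
  maximal ideal.\<close>

definition le :: "'a \<Rightarrow> 'a \<Rightarrow> bool" (infix "\<preceq>" 50) where
  "x \<preceq> y \<longleftrightarrow> (\<exists>r\<in>R. x = r * y)"

abbreviation less :: "'a \<Rightarrow> 'a \<Rightarrow> bool" (infix "\<prec>" 50) where
  "x \<prec> y \<equiv> \<not> y \<preceq> x"

lemma le_refl [simp]: "x \<preceq> x"
  unfolding le_def by (rule bexI[of _ 1]) (auto simp: one_mem)

lemma le_trans [trans]: "x \<preceq> y \<Longrightarrow> y \<preceq> z \<Longrightarrow> x \<preceq> z"
  unfolding le_def by (metis mult.assoc mult_mem)

lemma zero_le [simp]: "0 \<preceq> x"
  unfolding le_def by (rule bexI[of _ 0]) (auto intro: subring_setD[OF subring_set])

lemma le_zero_iff [simp]: "x \<preceq> 0 \<longleftrightarrow> x = 0"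
  unfolding le_def using one_mem by auto

lemma le_total: "x \<preceq> y \<or> y \<preceq> x"
proof (cases "x = 0 \<or> y = 0")
  case False
  then show ?thesis
    using total_mem[of "x / y"] by (force simp: le_def)
qed auto

lemma less_imp_le: "x \<prec> y \<Longrightarrow> x \<preceq> y"
  using le_total by blast

lemma le_less_trans [trans]: "x \<preceq> y \<Longrightarrow> y \<prec> z \<Longrightarrow> x \<prec> z"
  using le_trans by blast

lemma less_trans [trans]: "x \<prec> y \<Longrightarrow> y \<prec> z \<Longrightarrow> x \<prec> z"
  using le_trans le_total by blast

lemma minus_le_iff [simp]: "- x \<preceq> y \<longleftrightarrow> x \<preceq> y"
  unfolding le_def using subring_setD(5)[OF subring_set]
  by (metis minus_equation_iff minus_mult_left)

lemma add_le: "x \<preceq> z \<Longrightarrow> y \<preceq> z \<Longrightarrow> x + y \<preceq> z"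
  unfolding le_def using subring_setD(6)[OF subring_set] by (metis distrib_right)

lemma diff_le: "x \<preceq> z \<Longrightarrow> y \<preceq> z \<Longrightarrow> x - y \<preceq> z"
  using add_le[of x z "- y"] by simp

lemma sum_le: "(\<And>i. i \<in> I \<Longrightarrow> f i \<preceq> z) \<Longrightarrow> sum f I \<preceq> z"
  by (induction I rule: infinite_finite_induct) (auto intro: add_le)

lemma add_less: "x \<prec> z \<Longrightarrow> y \<prec> z \<Longrightarrow> x + y \<prec> z"
  using add_le[of x x y] add_le[of x y y] le_total[of x y] le_trans le_refl by blast

lemma minus_less_iff [simp]: "- x \<prec> y \<longleftrightarrow> x \<prec> y"
proof -
  have "y \<preceq> - x \<longleftrightarrow> y \<preceq> x" using le_trans[of y x "- x"] le_trans[of y "- x" x]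
    by (metis add.inverse_inverse le_refl minus_le_iff)
  then show ?thesis by simp
qed

lemma diff_less: "x \<prec> z \<Longrightarrow> y \<prec> z \<Longrightarrow> x - y \<prec> z"
  using add_less[of z x "- y"] by simp

lemma sum_less: "z \<noteq> 0 \<Longrightarrow> (\<And>i. i \<in> I \<Longrightarrow> f i \<prec> z) \<Longrightarrow> sum f I \<prec> z"
proof (induction I rule: infinite_finite_induct)
  case (insert i I)
  then show ?case using add_less[of z "f i" "sum f I"] by simp
qed simp_all

lemma mult_mono: "x \<preceq> y \<Longrightarrow> u \<preceq> v \<Longrightarrow> x * u \<preceq> y * v"
proof -
  assume "x \<preceq> y" "u \<preceq> v"
  then obtain r s where "r \<in> R" "s \<in> R" "x = r * y" "u = s * v" by (auto simp: le_def)
  then show ?thesis unfolding le_def by (intro bexI[of _ "r * s"] mult_mem) auto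
qed

lemma mult_le_cancel: "z \<noteq> 0 \<Longrightarrow> x * z \<preceq> y * z \<longleftrightarrow> x \<preceq> y"
  by (auto simp: le_def mult.assoc[symmetric])

lemma mult_less: "x \<prec> y \<Longrightarrow> u \<preceq> v \<Longrightarrow> v \<noteq> 0 \<Longrightarrow> x * u \<prec> y * v"
  using mult_le_cancel[of v y x] mult_mono[OF le_refl[of x], of u v] le_trans by blast

lemma mult_le_one: "x \<preceq> 1 \<Longrightarrow> y \<preceq> 1 \<Longrightarrow> x * y \<preceq> 1"
  using mult_mono[of x 1 y 1] by simp

lemma mult_less_one: "x \<prec> 1 \<Longrightarrow> y \<preceq> 1 \<Longrightarrow> x * y \<prec> 1"
  using mult_less[of 1 x y 1] by simp

lemma power_mono: "x \<preceq> y \<Longrightarrow> x ^ k \<preceq> y ^ k"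
  by (induction k) (auto intro: mult_mono)

lemma power_strict_mono: "x \<prec> y \<Longrightarrow> 0 < k \<Longrightarrow> x ^ k \<prec> y ^ k"
proof (induction k)
  case (Suc k)
  from Suc.prems have "y \<noteq> 0" by auto
  then show ?case
    using mult_less[OF Suc.prems(1), of "x ^ k" "y ^ k"] power_mono[of x y k] less_imp_le Suc.prems
    by simp
qed simp

lemma power_le_cancel: "x ^ k \<preceq> y ^ k \<Longrightarrow> 0 < k \<Longrightarrow> x \<preceq> y"
  using power_strict_mono by blast

lemma one_le_power: "1 \<preceq> x \<Longrightarrow> 1 \<preceq> x ^ k"
  using power_mono[of 1 x k] by simp

lemma power_le_one: "x \<preceq> 1 \<Longrightarrow> x ^ k \<preceq> 1"
  using power_mono[of x 1 k] by simp

lemma prod_le_power: "(\<And>i. i \<in> I \<Longrightarrow> f i \<preceq> z) \<Longrightarrow> prod f I \<preceq> z ^ card I"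
  by (induction I rule: infinite_finite_induct) (auto intro: mult_mono)

lemma of_nat_le_one: "of_nat k \<preceq> 1"
  by (induction k) (auto intro: add_le)

lemma of_int_le_one: "of_int k \<preceq> 1"
  by (cases k) (auto simp: of_nat_le_one simp del: of_nat_Suc)

lemma add_power_le:
  assumes "x ^ d \<preceq> t" "y ^ d \<preceq> t"
  shows "(x + y) ^ d \<preceq> t"
proof -
  have "x + y \<preceq> x \<or> x + y \<preceq> y"
    using le_total[of x y] add_le[of x x y] add_le[of x y y] by auto
  then show ?thesis using assms power_mono le_trans by blast
qed

lemma add_power_less:
  assumes "x ^ d \<prec> t" "y ^ d \<prec> t"
  shows "(x + y) ^ d \<prec> t"
proof -
  have "x + y \<preceq> x \<or> x + y \<preceq> y"
    using le_total[of x y] add_le[of x x y] add_le[of x y y] by auto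
  then show ?thesis using assms power_mono le_trans by blast
qed

lemma sum_power_less:
  assumes "t \<noteq> 0" "0 < d" "\<And>i. i \<in> I \<Longrightarrow> f i ^ d \<prec> t"
  shows "(sum f I) ^ d \<prec> t"
  using assms(3)
proof (induction I rule: infinite_finite_induct)
  case (insert i I)
  then show ?case using add_power_less[of t "f i" d "sum f I"] by simp
qed (use assms(1,2) in \<open>simp_all add: zero_power\<close>)

lemma inverse_le_one:
  assumes "1 \<preceq> x"
  shows "1 / x \<preceq> 1"
proof -
  have "x \<noteq> 0" using assms by auto
  then show ?thesis using mult_mono[OF assms le_refl[of "1 / x"]] by simp
qed

lemma exists_maximal:
  assumes "finite I" "I \<noteq> {}"
  shows "\<exists>i\<in>I. \<forall>j\<in>I. f j \<preceq> f i"
  using assms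
proof (induction I rule: finite_ne_induct)
  case (insert i I)
  then obtain k where "k \<in> I" "\<forall>j\<in>I. f j \<preceq> f k" by blast
  then show ?case using le_total[of "f i" "f k"] le_trans by (metis insert_iff le_refl)
qed simp

end

context residue_char_valuation_ring
begin

lemma of_nat_p_less_one: "of_nat p \<prec> 1"
proof
  assume "1 \<preceq> of_nat p"
  then obtain r where "r \<in> R" "1 = r * of_nat p" by (auto simp: le_def)
  then have "inverse (of_nat p) = r" by (metis inverse_unique mult.commute)
  then show False using inverse_p_notin \<open>r \<in> R\<close> by simp
qed

lemma one_le_of_nat:
  assumes "\<not> p dvd k"
  shows "1 \<preceq> of_nat k"
proof (rule ccontr)
  assume less: "of_nat k \<prec> 1"
  have "coprime (int p) (int k)"
    using assms prime_p by (simp add: prime_imp_coprime)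
  then obtain u v where "u * int p + v * int k = 1"
    using bezout_int[of "int p" "int k"] by auto
  then have "of_int (u * int p + v * int k) = (1 :: 'a)" by simp
  then have eq: "of_nat p * of_int u + of_nat k * of_int v = (1 :: 'a)" by (simp add: mult.commute)
  have "of_nat p * of_int u + of_nat k * of_int v \<prec> 1"
    using less by (intro add_less mult_less_one of_nat_p_less_one of_int_le_one)
  then show False by (simp add: eq)
qed

lemma prime_power_less_one: "0 < e \<Longrightarrow> of_nat (p ^ e) \<prec> 1"
  using power_strict_mono[OF of_nat_p_less_one, of e] by simp

text \<open>A number \<open>0 < k < p ^ e\<close> contains fewer factors \<open>p\<close> than \<open>p ^ e\<close>. This is where the degree has to
  be a prime power: it makes the factors \<open>d/k\<close> in the middle coefficients of \<open>critF\<close> small.\<close>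

lemma prime_power_div_less_one:
  assumes "0 < k" "k < p ^ e"
  shows "of_nat (p ^ e) / of_nat k \<prec> 1"
proof
  assume le: "1 \<preceq> of_nat (p ^ e) / of_nat k"
  have p0: "(of_nat p :: 'a) \<noteq> 0" using prime_p by auto
  have "\<not> is_unit p" using prime_p by auto
  then obtain m where m: "\<not> p dvd m" "k = p ^ multiplicity p k * m"
    using multiplicity_decompose'[of k p] assms by auto
  define f where "f = multiplicity p k"
  have m0: "m \<noteq> 0" using m by (metis dvd_0_right)
  have "p ^ f \<le> k" using assms(1) unfolding f_def by (intro dvd_imp_le multiplicity_dvd) auto
  then have "p ^ f < p ^ e" using assms by simp
  then have "f < e" using prime_p by (meson power_less_imp_less_exp prime_gt_1_nat)
  then obtain g where e: "e = f + g" "0 < g" by (metis less_imp_add_positive)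
  have eq: "of_nat (p ^ e) / of_nat k = (of_nat (p ^ g) / of_nat m :: 'a)"
    using m(2) p0 by (simp add: e power_add f_def[symmetric])
  have "of_nat m \<preceq> of_nat (p ^ g)"
    using mult_mono[OF le le_refl[of "of_nat m"]] m0 unfolding eq by simp
  then show False
    using prime_power_less_one[OF e(2)] one_le_of_nat[OF m(1)] le_trans by blast
qed

lemma prime_power_ge_2: "0 < e \<Longrightarrow> 2 \<le> p ^ e"
  using one_less_power[OF prime_gt_1_nat[OF prime_p], of e] by simp

lemma one_le_prime_power_minus_1:
  assumes "0 < e"
  shows "1 \<preceq> of_nat (p ^ e - 1)"
proof (rule one_le_of_nat, rule notI)
  assume "p dvd p ^ e - 1"
  moreover have "p dvd p ^ e" using assms by simp
  ultimately have "p dvd p ^ e - (p ^ e - 1)" by (rule dvd_diff_nat[rotated])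
  then show False using prime_power_ge_2[OF assms] prime_p by (simp add: not_prime_unit)
qed

text \<open>The Frobenius power \<open>x \<mapsto> x ^ d\<close> is additive modulo the maximal ideal, here scaled by \<open>t\<close>: the
  binomial coefficient \<open>d choose k = d/k * ((d - 1) choose (k - 1))\<close> inherits smallness from \<open>d/k\<close>.\<close>

lemma frobenius_less:
  assumes d: "d = p ^ e" "0 < e" and t: "t \<noteq> 0" and x: "x ^ d \<preceq> t" and y: "y ^ d \<preceq> t"
  shows "(x + y) ^ d - x ^ d - y ^ d \<prec> t"
proof -
  have dpos: "0 < d" using prime_power_ge_2[OF d(2)] unfolding d(1) by linarith
  have "(x + y) ^ d = (\<Sum>k\<in>{..d}. of_nat (d choose k) * x ^ k * y ^ (d - k))"
    by (simp add: binomial_ring)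
  also have "{..d} = {0, d} \<union> {0<..<d}" using dpos by auto
  also have "(\<Sum>k\<in>\<dots>. of_nat (d choose k) * x ^ k * y ^ (d - k))
      = x ^ d + y ^ d + (\<Sum>k\<in>{0<..<d}. of_nat (d choose k) * x ^ k * y ^ (d - k))"
    using dpos by (subst sum.union_disjoint) auto
  finally have "(x + y) ^ d - x ^ d - y ^ d
      = (\<Sum>k\<in>{0<..<d}. of_nat (d choose k) * (x ^ k * y ^ (d - k)))"
    by (simp add: mult.assoc)
  also have "\<dots> \<prec> t"
  proof (rule sum_less[OF t])
    fix k assume "k \<in> {0<..<d}"
    then have k: "0 < k" "k < d" by auto
    have "k * (d choose k) = d * ((d - 1) choose (k - 1))"
      using times_binomial_minus1_eq[of k d] k by simp
    then have "of_nat k * of_nat (d choose k) = (of_nat d * of_nat ((d - 1) choose (k - 1)) :: 'a)"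
      by (metis of_nat_mult)
    then have "of_nat (d choose k) = (of_nat d / of_nat k * of_nat ((d - 1) choose (k - 1)) :: 'a)"
      using k by (simp add: field_simps)
    also have "\<dots> \<prec> 1"
      using prime_power_div_less_one[of k e] k d of_nat_le_one by (intro mult_less_one) auto
    finally have c: "of_nat (d choose k) \<prec> (1 :: 'a)" .
    have "x ^ k * y ^ (d - k) \<preceq> t"
    proof (rule power_le_cancel[OF _ dpos])
      have "(x ^ k * y ^ (d - k)) ^ d = (x ^ d) ^ k * (y ^ d) ^ (d - k)"
        by (simp add: power_mult_distrib mult.commute flip: power_mult)
      also have "\<dots> \<preceq> t ^ k * t ^ (d - k)"
        using x y by (intro mult_mono power_mono)
      also have "\<dots> = t ^ d" using k by (simp flip: power_add)
      finally show "(x ^ k * y ^ (d - k)) ^ d \<preceq> t ^ d" .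
    qed
    then show "of_nat (d choose k) * (x ^ k * y ^ (d - k)) \<prec> t"
      using mult_less[OF c _ t] by simp
  qed
  finally show ?thesis .
qed

end

section \<open>Integrality of parameters with periodic critical points\<close>

context residue_char_valuation_ring
begin

text \<open>On the slice \<open>amean id d a = 0\<close> the polynomial \<open>critF\<close> is \<open>z ^ d + b\<close> plus this error term, which
  is small compared with \<open>t\<close> as soon as \<open>z ^ d\<close> and all \<open>a i ^ d\<close> are of size at most \<open>t\<close>: it is
  homogeneous of degree \<open>d\<close> in \<open>a\<close> and \<open>z\<close>, with all coefficients in the maximal ideal.\<close>

definition lower_part :: "nat \<Rightarrow> (nat \<Rightarrow> 'a) \<Rightarrow> 'a \<Rightarrow> 'a" where
  "lower_part d a z =
     (\<Sum>k=1..d - 1. (-1) ^ (d - k) * (of_nat d / of_nat k) * esym (d - 1) (d - k) a * z ^ k)"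

lemma critF_eq_lower_part:
  assumes "2 \<le> d" "amean id d a = 0"
  shows "critF id d a b z = z ^ d + b + lower_part d a z"
  using assms by (simp add: critF_def lower_part_def)

lemma lower_part_less:
  assumes d: "d = p ^ e" "0 < e" and t: "t \<noteq> 0"
    and a: "\<And>i. i \<in> {1..d - 1} \<Longrightarrow> a i ^ d \<preceq> t" and z: "z ^ d \<preceq> t"
  shows "lower_part d a z \<prec> t"
  unfolding lower_part_def
proof (rule sum_less[OF t])
  fix k assume "k \<in> {1..d - 1}"
  then have k: "0 < k" "k < d" by auto
  have dpos: "0 < d" using k by simp
  have "esym (d - 1) (d - k) a * z ^ k
      = (\<Sum>S | S \<subseteq> {1..d - 1} \<and> card S = d - k. (\<Prod>i\<in>S. a i) * z ^ k)"
    by (simp add: esym_def sum_distrib_right)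
  also have "\<dots> \<preceq> t"
  proof (rule sum_le, rule power_le_cancel[OF _ dpos])
    fix S assume "S \<in> {S. S \<subseteq> {1..d - 1} \<and> card S = d - k}"
    then have S: "S \<subseteq> {1..d - 1}" "card S = d - k" by auto
    have "((\<Prod>i\<in>S. a i) * z ^ k) ^ d = (\<Prod>i\<in>S. a i ^ d) * (z ^ d) ^ k"
      by (simp add: power_mult_distrib prod_power_distrib mult.commute flip: power_mult)
    also have "\<dots> \<preceq> t ^ card S * t ^ k"
      using a S z by (intro mult_mono prod_le_power power_mono) auto
    also have "\<dots> = t ^ d" using k S by (simp flip: power_add)
    finally show "((\<Prod>i\<in>S. a i) * z ^ k) ^ d \<preceq> t ^ d" .
  qed
  finally have le: "(-1) ^ (d - k) * (esym (d - 1) (d - k) a * z ^ k) \<preceq> t"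
    by (cases "even (d - k)") auto
  have "of_nat d / of_nat k * ((-1) ^ (d - k) * (esym (d - 1) (d - k) a * z ^ k)) \<prec> t"
    using mult_less[OF prime_power_div_less_one[of k e] le t] k d by simp
  then show "(-1) ^ (d - k) * (of_nat d / of_nat k) * esym (d - 1) (d - k) a * z ^ k \<prec> t"
    by (simp add: mult_ac)
qed

text \<open>A normalised polynomial all of whose critical points are periodic has potentially good reduction at
  \<open>p\<close>, and here even integral parameters. Let \<open>t\<close> be the largest of \<open>b\<close> and the \<open>a i ^ d\<close>, and suppose
  \<open>1 \<prec> t\<close>. A point \<open>z\<close> with \<open>t \<prec> z ^ d\<close> escapes, since \<open>critF\<close> there is as large as \<open>z ^ d\<close>. Hence
  \<open>F (a i)\<close> does not lie in the escape region, which forces \<open>a i ^ d + b \<prec> t\<close>: modulo smaller terms all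
  \<open>a i ^ d\<close> equal \<open>- b\<close>, so by additivity of Frobenius all \<open>a i\<close> agree. As they sum to \<open>0\<close> and \<open>d - 1\<close> is
  a unit, each of them is small, and then so is \<open>b\<close>, contradicting the choice of \<open>t\<close>.\<close>

lemma periodic_critical_points_integral:
  assumes d: "d = p ^ e" "0 < e" and mean: "amean id d a = 0"
    and n: "\<And>i. i \<in> {1..d - 1} \<Longrightarrow> 1 \<le> n i"
    and per: "\<And>i. i \<in> {1..d - 1} \<Longrightarrow> (critF id d a b ^^ n i) (a i) = a i"
  shows "b \<preceq> 1 \<and> (\<forall>i\<in>{1..d - 1}. a i \<preceq> 1)"
proof -
  have d2: "2 \<le> d" using prime_power_ge_2[OF d(2)] unfolding d(1) .
  then have dpos: "0 < d" by simp
  define F where "F = critF id d a b"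
  have F: "F z = z ^ d + b + lower_part d a z" for z
    using critF_eq_lower_part[OF d2 mean] by (simp add: F_def)
  \<comment> \<open>Comparing \<open>b\<close> with the \<open>d\<close>-th powers of the \<open>a i\<close> avoids a \<open>d\<close>-th root of \<open>b\<close>.\<close>
  define c where "c j = (if j = 0 then b else a j ^ d)" for j
  obtain j where "j \<in> {0..d - 1}" and j_max: "\<forall>i\<in>{0..d - 1}. c i \<preceq> c j"
    using exists_maximal[of "{0..d - 1}" c] by auto
  define t where "t = c j"
  have b_le: "b \<preceq> t" using j_max by (force simp: t_def c_def)
  have a_le: "a i ^ d \<preceq> t" if "i \<in> {1..d - 1}" for i
    using j_max that by (force simp: t_def c_def)
  have "t \<preceq> 1"
  proof (rule ccontr)
    assume t1: "1 \<prec> t"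
    then have t0: "t \<noteq> 0" by auto
    have escape: "t \<prec> F z ^ d" if z: "t \<prec> z ^ d" for z
    proof -
      have z0: "z ^ d \<noteq> 0" using z zero_le by metis
      have z1: "1 \<preceq> z ^ d" using t1 z less_trans less_imp_le by blast
      have "z ^ d \<preceq> F z"
      proof (rule ccontr)
        assume "F z \<prec> z ^ d"
        moreover have "b \<prec> z ^ d" using b_le z by (rule le_less_trans)
        moreover have "lower_part d a z \<prec> z ^ d"
          using a_le z less_imp_le le_trans by (intro lower_part_less[OF d z0]) blast+
        ultimately have "F z - b - lower_part d a z \<prec> z ^ d"
          by (intro diff_less)
        then show False by (simp add: F)
      qed
      then have "(z ^ d) ^ d \<preceq> F z ^ d" by (rule power_mono)
      moreover have "z ^ d \<preceq> (z ^ d) ^ d"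
        using mult_mono[OF le_refl one_le_power[OF z1, of "d - 1"], of "z ^ d"] dpos
        by (simp flip: power_Suc)
      ultimately show ?thesis using z le_trans by blast
    qed
    have orbit_escapes: "t \<prec> (F ^^ Suc k) z ^ d" if "t \<prec> F z ^ d" for k z
    proof (induction k)
      case (Suc k)
      then show ?case using escape by simp
    qed (use that in simp)
    have near: "a i ^ d + b \<prec> t" if i: "i \<in> {1..d - 1}" for i
    proof -
      obtain k where k: "n i = Suc k" using n[OF i] by (metis Suc_le_D One_nat_def)
      have "F (a i) ^ d \<preceq> t"
        using orbit_escapes[of "a i" k] per[OF i] a_le[OF i] by (auto simp: k F_def)
      have "F (a i) \<prec> t"
      proof
        assume "t \<preceq> F (a i)"
        then have "t ^ d \<preceq> t"
          using power_mono \<open>F (a i) ^ d \<preceq> t\<close> le_trans by blast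
        then have "t ^ (d - 1) * t \<preceq> 1 * t" using dpos by (simp flip: power_Suc2)
        then have "t ^ (d - 1) \<preceq> 1" using mult_le_cancel[OF t0] by blast
        then show False
          using power_strict_mono[OF t1, of "d - 1"] d2 by simp
      qed
      then have "F (a i) - lower_part d a (a i) \<prec> t"
        using lower_part_less[OF d t0 a_le a_le[OF i]] by (intro diff_less)
      then show ?thesis by (simp add: F)
    qed
    have close: "(a i - a k) ^ d \<prec> t" if i: "i \<in> {1..d - 1}" and k: "k \<in> {1..d - 1}" for i k
    proof -
      \<comment> \<open>Frobenius is applied to \<open>a i = (a i - a k) + a k\<close>, which avoids the sign \<open>(-1) ^ d\<close>.\<close>
      have neg: "(- a k) ^ d \<preceq> t"
        using a_le[OF k] by (cases "even d") auto
      have u: "(a i - a k) ^ d \<preceq> t"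
        using add_power_le[OF a_le[OF i] neg] by simp
      have fr: "a i ^ d - (a i - a k) ^ d - a k ^ d \<prec> t"
        using frobenius_less[OF d t0 u a_le[OF k]] by simp
      have "(a i ^ d + b) - (a k ^ d + b) \<prec> t"
        using near[OF i] near[OF k] by (rule diff_less)
      from diff_less[OF this fr] show ?thesis by simp
    qed
    have a_less: "a k ^ d \<prec> t" if k: "k \<in> {1..d - 1}" for k
    proof
      assume le: "t \<preceq> a k ^ d"
      have sum0: "(\<Sum>i=1..d - 1. a i) = 0" using mean d2 by (simp add: amean_def)
      have sum_eq: "(\<Sum>i=1..d - 1. a i - a k) = - (of_nat (d - 1) * a k)"
        using sum0 by (simp add: sum_subtractf)
      have "(\<Sum>i=1..d - 1. a i - a k) ^ d \<prec> t"
        using close k by (intro sum_power_less t0 dpos) auto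
      then have "(of_nat (d - 1) * a k) ^ d \<prec> t"
        by (simp only: sum_eq) (cases "even d"; simp)
      moreover have "1 \<preceq> of_nat (d - 1) ^ d"
        using one_le_prime_power_minus_1[OF d(2)] d(1) by (intro one_le_power) simp
      then have "1 * a k ^ d \<preceq> of_nat (d - 1) ^ d * a k ^ d"
        by (intro mult_mono le_refl)
      ultimately show False using le le_trans unfolding power_mult_distrib mult_1 by blast
    qed
    have one: "1 \<in> {1..d - 1}" using d2 by simp
    have "b \<prec> t" using diff_less[OF near[OF one] a_less[OF one]] by simp
    moreover have "c j \<preceq> b \<or> (\<exists>k\<in>{1..d - 1}. c j \<preceq> a k ^ d)"
      using \<open>j \<in> {0..d - 1}\<close> by (cases "j = 0") (auto simp: c_def intro!: bexI[of _ j])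
    ultimately show False using a_less by (auto simp: t_def)
  qed
  then have "b \<preceq> 1" using b_le le_trans by blast
  moreover have "a i \<preceq> 1" if "i \<in> {1..d - 1}" for i
  proof (rule power_le_cancel[OF _ dpos])
    show "a i ^ d \<preceq> 1 ^ d" using le_trans[OF a_le[OF that] \<open>t \<preceq> 1\<close>] by simp
  qed
  ultimately show ?thesis by blast
qed

end

section \<open>Partial derivatives and differentials\<close>

lemma mpderiv_superset:
  assumes "finite A" "Poly_Mapping.keys P \<subseteq> A"
  shows "mpderiv j P = (\<Sum>m\<in>A. Poly_Mapping.single (m - Poly_Mapping.single j 1)
       (of_nat (Poly_Mapping.lookup m j) * Poly_Mapping.lookup P m))"
  unfolding mpderiv_def
  by (rule sum.mono_neutral_left) (use assms in \<open>auto simp: in_keys_iff\<close>)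

lemma mpderiv_0 [simp]: "mpderiv j 0 = 0"
  by (simp add: mpderiv_def)

lemma mpderiv_add: "mpderiv j (P + Q) = mpderiv j P + mpderiv j Q"
proof -
  let ?A = "Poly_Mapping.keys P \<union> Poly_Mapping.keys Q"
  show ?thesis
    by (simp add: mpderiv_superset[of ?A] Poly_Mapping.keys_add lookup_add sum.distrib
        distrib_left single_add)
qed

lemma mpderiv_sum: "mpderiv j (sum P I) = (\<Sum>i\<in>I. mpderiv j (P i))"
  by (induction I rule: infinite_finite_induct) (simp_all add: mpderiv_add)

lemma mpderiv_single:
  "mpderiv j (Poly_Mapping.single m c) =
     Poly_Mapping.single (m - Poly_Mapping.single j 1) (of_nat (Poly_Mapping.lookup m j) * c)"
  by (simp add: mpderiv_def)

lemma mpderiv_mult_single: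
  fixes c c' :: "'a::comm_ring_1"
  shows "mpderiv j (Poly_Mapping.single m c * Poly_Mapping.single m' c') =
     mpderiv j (Poly_Mapping.single m c) * Poly_Mapping.single m' c'
     + Poly_Mapping.single m c * mpderiv j (Poly_Mapping.single m' c')"
proof -
  let ?s = "Poly_Mapping.single j (1 :: nat)"
  have shift: "m + m' - ?s = (m - ?s) + m'" if "Poly_Mapping.lookup m j > 0" for m m' :: "nat \<Rightarrow>\<^sub>0 nat"
    by (rule poly_mapping_eqI)
       (use that in \<open>auto simp: lookup_add lookup_minus lookup_single when_def\<close>)
  have "Poly_Mapping.single (m + m' - ?s) (of_nat (Poly_Mapping.lookup m j) * (c * c')) =
      Poly_Mapping.single ((m - ?s) + m') (of_nat (Poly_Mapping.lookup m j) * c * c')"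
    by (cases "Poly_Mapping.lookup m j = 0") (simp_all add: shift[simplified] mult.assoc)
  moreover have "Poly_Mapping.single (m + m' - ?s) (of_nat (Poly_Mapping.lookup m' j) * (c * c')) =
      Poly_Mapping.single (m + (m' - ?s)) (c * (of_nat (Poly_Mapping.lookup m' j) * c'))"
    using shift[of m' m, simplified]
    by (cases "Poly_Mapping.lookup m' j = 0") (simp_all add: add.commute mult_ac)
  ultimately show ?thesis
    by (simp add: mult_single mpderiv_single lookup_add distrib_right single_add)
qed

lemma mpderiv_mult: "mpderiv j (P * Q) = mpderiv j P * Q + P * mpderiv j Q"
proof -
  let ?s = "\<lambda>R m. Poly_Mapping.single m (Poly_Mapping.lookup R m)"
  let ?P = "\<Sum>m\<in>Poly_Mapping.keys P. ?s P m" and ?Q = "\<Sum>m\<in>Poly_Mapping.keys Q. ?s Q m"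
  have "mpderiv j (?P * ?Q) = mpderiv j ?P * ?Q + ?P * mpderiv j ?Q"
    unfolding sum_product mpderiv_sum mpderiv_mult_single sum.distrib ..
  then show ?thesis using mpoly_sum_single[of P] mpoly_sum_single[of Q] by simp
qed

lemma mpderiv_mconst [simp]: "mpderiv j (mconst c) = 0"
  by (simp add: mconst_def mpderiv_single)

lemma mpderiv_mvar: "mpderiv j (mvar k) = (if j = k then 1 else 0)"
  by (simp add: mvar_def mpderiv_single lookup_single when_def)

context
  fixes d :: nat and x v :: "'a::field_char_0 pt"
begin

lemma differential_0 [simp]: "differential d 0 x v = 0"
  by (simp add: differential_def)

lemma differential_add: "differential d (P + Q) x v = differential d P x v + differential d Q x v"
  by (simp add: differential_def mpderiv_add meval_add distrib_right sum.distrib)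

lemma differential_minus: "differential d (- P) x v = - differential d P x v"
  using differential_add[of P "- P"] by (simp add: eq_neg_iff_add_eq_0 add.commute)

lemma differential_diff: "differential d (P - Q) x v = differential d P x v - differential d Q x v"
  using differential_add[of P "- Q"] by (simp add: differential_minus)

lemma differential_mult:
  "differential d (P * Q) x v =
     differential d P x v * meval Q (coord x) + meval P (coord x) * differential d Q x v"
  by (simp add: differential_def mpderiv_mult meval_add meval_mult sum.distrib
      sum_distrib_left sum_distrib_right distrib_left distrib_right mult_ac)

lemma differential_mconst [simp]: "differential d (mconst c) x v = 0"
  by (simp add: differential_def)

lemma differential_1 [simp]: "differential d 1 x v = 0"
  using differential_mconst[of 1] by (simp add: mconst_def)

lemma differential_mvar: "k < d \<Longrightarrow> differential d (mvar k) x v = coord v k"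
  by (simp add: differential_def mpderiv_mvar if_distrib if_distribR cong: if_cong)

lemma differential_power:
  "differential d (P ^ k) x v =
     of_nat k * meval P (coord x) ^ (k - 1) * differential d P x v"
proof (induction k)
  case (Suc k)
  then show ?case
    by (cases k) (simp_all add: differential_mult meval_mult meval_power algebra_simps)
qed simp

end

section \<open>Differentials modulo the maximal ideal\<close>

lemma sum_closed:
  assumes "C 0" "\<And>P Q. C P \<Longrightarrow> C Q \<Longrightarrow> C (P + Q)" "\<And>i. i \<in> I \<Longrightarrow> C (f i)"
  shows "C (sum f I :: 'b::comm_monoid_add)"
  using assms(3) by (induction I rule: infinite_finite_induct) (auto intro: assms)

context residue_char_valuation_ring
begin

text \<open>For a fixed point \<open>x\<close> and tangent vector \<open>v\<close>, a polynomial is recorded only through its value at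
  \<open>x\<close> and its derivative along \<open>v\<close>. Those with integral value and integral derivative form a subring; a
  flat polynomial is one that is constant to first order along \<open>v\<close> modulo the maximal ideal.\<close>

definition integral_jet :: "nat \<Rightarrow> 'a pt \<Rightarrow> 'a pt \<Rightarrow> 'a mpoly \<Rightarrow> bool" where
  "integral_jet d x v P \<longleftrightarrow> meval P (coord x) \<preceq> 1 \<and> differential d P x v \<preceq> 1"

definition flat_jet :: "nat \<Rightarrow> 'a pt \<Rightarrow> 'a pt \<Rightarrow> 'a mpoly \<Rightarrow> bool" where
  "flat_jet d x v P \<longleftrightarrow> meval P (coord x) \<preceq> 1 \<and> differential d P x v \<prec> 1"

context
  fixes d :: nat and x v :: "'a pt"
begin

abbreviation "integral \<equiv> integral_jet d x v"
abbreviation "flat \<equiv> flat_jet d x v"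

lemma flat_imp_integral: "flat P \<Longrightarrow> integral P"
  by (auto simp: flat_jet_def integral_jet_def intro: less_imp_le)

lemma integral_add: "integral P \<Longrightarrow> integral Q \<Longrightarrow> integral (P + Q)"
  and integral_diff: "integral P \<Longrightarrow> integral Q \<Longrightarrow> integral (P - Q)"
  and integral_mult: "integral P \<Longrightarrow> integral Q \<Longrightarrow> integral (P * Q)"
  and integral_mconst: "c \<preceq> 1 \<Longrightarrow> integral (mconst c)"
  and integral_1: "integral 1"
  and integral_0: "integral 0"
  by (auto simp: integral_jet_def meval_hom differential_add differential_diff differential_mult
      intro: add_le diff_le mult_le_one)

lemma flat_add: "flat P \<Longrightarrow> flat Q \<Longrightarrow> flat (P + Q)"
  and flat_diff: "flat P \<Longrightarrow> flat Q \<Longrightarrow> flat (P - Q)"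
  and flat_0: "flat 0"
  using add_less[of 1 "differential d P x v" "differential d Q x v"]
    diff_less[of 1 "differential d P x v" "differential d Q x v"]
  by (auto simp: flat_jet_def meval_hom differential_add differential_diff
      intro: add_le diff_le)

lemma integral_power: "integral P \<Longrightarrow> integral (P ^ k)"
  by (induction k) (auto intro: integral_mult integral_1)

lemma integral_prod: "(\<And>i. i \<in> I \<Longrightarrow> integral (f i)) \<Longrightarrow> integral (prod f I)"
  by (induction I rule: infinite_finite_induct) (auto intro: integral_mult integral_1)

lemma integral_sum: "(\<And>i. i \<in> I \<Longrightarrow> integral (f i)) \<Longrightarrow> integral (sum f I)"
  by (rule sum_closed) (auto intro: integral_add integral_0)

lemma flat_sum: "(\<And>i. i \<in> I \<Longrightarrow> flat (f i)) \<Longrightarrow> flat (sum f I)"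
  by (rule sum_closed) (auto intro: flat_add flat_0)

lemma flat_mconst_mult:
  assumes "c \<prec> 1" "integral P"
  shows "flat (mconst c * P)"
  using assms mult_less_one[of c "differential d P x v"]
    mult_le_one[OF less_imp_le[OF assms(1)], of "meval P (coord x)"]
  by (simp add: flat_jet_def integral_jet_def meval_mult differential_mult)

lemma flat_power:
  assumes "of_nat k \<prec> (1 :: 'a)" "integral P"
  shows "flat (P ^ k)"
proof -
  have "of_nat k * (meval P (coord x) ^ (k - 1) * differential d P x v) \<prec> 1"
    using assms by (intro mult_less_one mult_le_one power_le_one) (auto simp: integral_jet_def)
  then show ?thesis using assms
    by (simp add: flat_jet_def integral_jet_def meval_power differential_power mult.assoc power_le_one)
qed

text \<open>Modulo the maximal ideal \<open>critF\<close> is \<open>z ^ d + b - mean ^ d\<close>, and \<open>d\<close>-th powers have derivative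
  zero. So to first order \<open>critF\<close> depends on nothing but \<open>b\<close>.\<close>

lemma flat_critF_diff:
  assumes d: "d = p ^ e" "0 < e"
    and a: "\<And>i. i \<in> {1..d - 1} \<Longrightarrow> integral (a i)" and z: "integral z"
  shows "flat (critF mconst d a b z - b)"
proof -
  have d1: "of_nat d \<prec> (1 :: 'a)" using prime_power_less_one[OF d(2)] d(1) by simp
  have "1 / of_nat (d - 1) \<preceq> (1 :: 'a)"
    using one_le_prime_power_minus_1[OF d(2)] unfolding d(1) by (rule inverse_le_one)
  then have mean: "integral (amean mconst d a)"
    unfolding amean_def using a by (intro integral_mult integral_mconst integral_sum)
  have esym: "integral (esym (d - 1) k a)" for k
    unfolding esym_def using a by (intro integral_sum integral_prod) auto
  have sign: "integral ((- 1) ^ k)" for k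
    using integral_power[OF integral_diff[OF integral_0 integral_1], of k] by simp
  have summand: "flat ((-1) ^ (d - k) * mconst (of_nat d / of_nat k) * esym (d - 1) (d - k) a * w ^ k)"
    if "k \<in> {1..d - 1}" "integral w" for k w
  proof -
    have "0 < k" "k < p ^ e"
      using that(1) unfolding d(1)[symmetric] atLeastAtMost_iff by linarith+
    then have "of_nat d / of_nat k \<prec> (1 :: 'a)"
      unfolding d(1) by (rule prime_power_div_less_one)
    then have "flat (mconst (of_nat d / of_nat k) * ((-1) ^ (d - k) * (esym (d - 1) (d - k) a * w ^ k)))"
      using that(2)
      by (intro flat_mconst_mult integral_mult[OF sign] integral_mult[OF esym] integral_power)
    then show ?thesis by (simp only: mult_ac)
  qed
  let ?t = "\<lambda>w k. (-1) ^ (d - k) * mconst (of_nat d / of_nat k) * esym (d - 1) (d - k) a * w ^ k"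
  have "critF mconst d a b z - b =
      z ^ d + (\<Sum>k=1..d - 1. ?t z k) - amean mconst d a ^ d - (\<Sum>k=1..d - 1. ?t (amean mconst d a) k)"
    by (simp add: critF_def)
  also have "flat \<dots>"
    using summand mean z d1 by (intro flat_diff flat_add flat_sum flat_power)
  finally show ?thesis .
qed

text \<open>In the iterate \<open>F (F (\<dots> (a i)))\<close> only the outermost application of \<open>F\<close> matters, because \<open>F\<close>
  forgets the derivative of its argument. This gives \<open>da_i - db\<close> for the differential of the equation of
  \<open>V d n i\<close>, whatever the period is.\<close>

lemma differential_fpoly:
  assumes d: "d = p ^ e" "0 < e"
    and int: "\<And>j. j < d \<Longrightarrow> coord x j \<preceq> 1" "\<And>j. j < d \<Longrightarrow> coord v j \<preceq> 1"
    and i: "i \<in> {1..d - 1}" and n: "1 \<le> n i"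
  shows "differential d (fpoly d n i) x v - (coord v i - coord v 0) \<prec> 1"
proof -
  define F where "F = critF mconst d mvar (mvar 0 :: 'a mpoly)"
  have var: "integral (mvar j)" if "j < d" for j
    using int that by (simp add: integral_jet_def differential_mvar)
  have less: "0 < d" "i < d" using i unfolding atLeastAtMost_iff by linarith+
  have v0: "integral (mvar 0)" using var less by blast
  have step: "flat (F z - mvar 0)" if "integral z" for z
    unfolding F_def using that var by (intro flat_critF_diff[OF d]) auto
  have F: "integral (F z)" if "integral z" for z
    using integral_add[OF flat_imp_integral[OF step[OF that]] v0] by simp
  have it: "integral ((F ^^ k) (mvar i))" for k
    by (induction k) (use F var i in auto)
  obtain k where "n i = Suc k" using n by (metis Suc_le_D One_nat_def)
  then have "fpoly d n i = mvar i - F ((F ^^ k) (mvar i))"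
    by (simp add: fpoly_def orbit_eq_def F_def)
  then have "differential d (fpoly d n i) x v - (coord v i - coord v 0) =
      - differential d (F ((F ^^ k) (mvar i)) - mvar 0) x v"
    by (simp add: differential_diff differential_mvar less)
  then show ?thesis using step[OF it[of k]] by (simp add: flat_jet_def)
qed

end
end

section \<open>The Jacobian determinant\<close>

text \<open>A basis of \<open>H d\<close> on which the forms \<open>da_i - db\<close> take the values of the identity matrix: the
  \<open>a\<close>-entries of the \<open>j\<close>-th unit vector are shifted by their mean to land in \<open>H d\<close>, and taking the same
  shift for the \<open>b\<close>-entry cancels it in the difference.\<close>

definition dual_vector :: "nat \<Rightarrow> nat \<Rightarrow> 'a::field_char_0 pt" where
  "dual_vector d j =
     (\<lambda>k\<in>{1..d - 1}. (if k = j then 1 else 0) - 1 / of_nat (d - 1), - 1 / of_nat (d - 1))"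

lemma coord_dual_vector:
  "k < d \<Longrightarrow> j \<noteq> 0 \<Longrightarrow> coord (dual_vector d j) k = (if k = j then 1 else 0) - 1 / of_nat (d - 1)"
  by (auto simp: coord_def dual_vector_def)

lemma dual_vector_in_H:
  assumes "j \<in> {1..d - 1}"
  shows "dual_vector d j \<in> H d"
proof -
  have "d - 1 \<noteq> 0" using assms unfolding atLeastAtMost_iff by linarith
  then have "(of_nat (d - 1) :: 'a) \<noteq> 0" unfolding of_nat_eq_0_iff .
  moreover have "(\<Sum>k=1..d - 1. (if k = j then 1 else 0) - 1 / of_nat (d - 1)) =
      (1 - of_nat (d - 1) * (1 / of_nat (d - 1)) :: 'a)"
    using assms by (simp add: sum_subtractf del: of_nat_diff)
  ultimately show ?thesis
    by (simp add: H_def dual_vector_def amean_def del: of_nat_diff)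
qed

definition jacobian_matrix :: "nat \<Rightarrow> (nat \<Rightarrow> nat) \<Rightarrow> 'a::field_char_0 pt \<Rightarrow> 'a mat" where
  "jacobian_matrix d n y = mat (d - 1) (d - 1)
     (\<lambda>(r, s). differential d (fpoly d n (Suc s)) y (dual_vector d (Suc r)))"

text \<open>The polynomial whose value at \<open>y\<close> is the determinant of the matrix above; its non-vanishing locus
  is the open set of the theorem.\<close>

definition jacobian :: "nat \<Rightarrow> (nat \<Rightarrow> nat) \<Rightarrow> 'a::field_char_0 mpoly" where
  "jacobian d n = det (mat (d - 1) (d - 1)
     (\<lambda>(r, s). \<Sum>k<d. mpderiv k (fpoly d n (Suc s)) * mconst (coord (dual_vector d (Suc r)) k)))"

lemma meval_jacobian: "meval (jacobian d n) (coord y) = det (jacobian_matrix d n y)"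
proof -
  interpret comm_ring_hom "\<lambda>P :: 'a mpoly. meval P (coord y)"
    by unfold_locales (simp_all add: meval_hom)
  have "jacobian_matrix d n y = map_mat (\<lambda>P. meval P (coord y)) (mat (d - 1) (d - 1)
     (\<lambda>(r, s). \<Sum>k<d. mpderiv k (fpoly d n (Suc s)) * mconst (coord (dual_vector d (Suc r)) k)))"
    by (rule eq_matI) (auto simp: jacobian_matrix_def differential_def meval_hom)
  then show ?thesis by (simp add: jacobian_def)
qed

lemma jacobian_nonzero_iff:
  fixes y :: "'a::field_char_0 pt"
  shows "meval (jacobian d n) (coord y) \<noteq> 0 \<longleftrightarrow>
    (\<forall>c. (\<forall>j\<in>{1..d - 1}. (\<Sum>i\<in>{1..d - 1}. c i * differential d (fpoly d n i) y (dual_vector d j)) = 0)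
       \<longrightarrow> (\<forall>i\<in>{1..d - 1}. c i = 0))"
proof -
  let ?A = "jacobian_matrix d n y"
  let ?rel = "\<lambda>c. \<forall>j\<in>{1..d - 1}.
    (\<Sum>i\<in>{1..d - 1}. c i * differential d (fpoly d n i) y (dual_vector d j)) = 0"
  have A: "?A \<in> carrier_mat (d - 1) (d - 1)" by (simp add: jacobian_matrix_def)
  have shift: "(\<forall>i\<in>{1..d - 1}. P i) \<longleftrightarrow> (\<forall>i<d - 1. P (Suc i))" for P :: "nat \<Rightarrow> bool"
    by (metis One_nat_def Suc_le_eq Suc_pred atLeastAtMost_iff le_simps(2) less_Suc_eq_0_disj
        not_less_eq old.nat.exhaust zero_less_Suc less_Suc_eq_le)
  have entry: "(?A *\<^sub>v w) $ r = (\<Sum>i\<in>{1..d - 1}.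
      w $ (i - 1) * differential d (fpoly d n i) y (dual_vector d (Suc r)))"
    if "w \<in> carrier_vec (d - 1)" "r < d - 1" for w r
  proof -
    have "(?A *\<^sub>v w) $ r = (\<Sum>s\<in>{0..<d - 1}.
        w $ s * differential d (fpoly d n (Suc s)) y (dual_vector d (Suc r)))"
      using that by (simp add: jacobian_matrix_def scalar_prod_def mult.commute)
    also have "\<dots> = (\<Sum>i\<in>{1..d - 1}.
        w $ (i - 1) * differential d (fpoly d n i) y (dual_vector d (Suc r)))"
      by (rule sum.reindex_bij_witness[of _ "\<lambda>i. i - 1" Suc]) auto
    finally show ?thesis .
  qed
  have kernel: "?A *\<^sub>v w = 0\<^sub>v (d - 1) \<longleftrightarrow> ?rel (\<lambda>i. w $ (i - 1))"
    if w: "w \<in> carrier_vec (d - 1)" for w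
  proof -
    have "?A *\<^sub>v w = 0\<^sub>v (d - 1) \<longleftrightarrow> (\<forall>r<d - 1. (?A *\<^sub>v w) $ r = 0)"
      using A by (auto simp: vec_eq_iff)
    then show ?thesis unfolding shift using entry[OF w] by simp
  qed
  show ?thesis
    unfolding meval_jacobian det_0_iff_vec_prod_zero_field[OF A]
  proof (intro iffI allI impI)
    fix c assume no: "\<nexists>w. w \<in> carrier_vec (d - 1) \<and> w \<noteq> 0\<^sub>v (d - 1) \<and> ?A *\<^sub>v w = 0\<^sub>v (d - 1)"
      and c: "?rel c"
    define w where "w = vec (d - 1) (\<lambda>s. c (Suc s))"
    have w: "w \<in> carrier_vec (d - 1)" by (simp add: w_def)
    have wc: "w $ (i - 1) = c i" if "i \<in> {1..d - 1}" for i
      using that by (auto simp: w_def)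
    have "?A *\<^sub>v w = 0\<^sub>v (d - 1)"
      unfolding kernel[OF w] using c wc by simp
    then have "w = 0\<^sub>v (d - 1)" using no w by blast
    show "\<forall>i\<in>{1..d - 1}. c i = 0"
    proof
      fix i assume i: "i \<in> {1..d - 1}"
      then have "i - 1 < d - 1" unfolding atLeastAtMost_iff by linarith
      then show "c i = 0" using wc[OF i] \<open>w = 0\<^sub>v (d - 1)\<close> by simp
    qed
  next
    assume indep: "\<forall>c. ?rel c \<longrightarrow> (\<forall>i\<in>{1..d - 1}. c i = 0)"
    show "\<nexists>w. w \<in> carrier_vec (d - 1) \<and> w \<noteq> 0\<^sub>v (d - 1) \<and> ?A *\<^sub>v w = 0\<^sub>v (d - 1)"
    proof (intro notI, elim exE conjE)
      fix w assume w: "w \<in> carrier_vec (d - 1)" "w \<noteq> 0\<^sub>v (d - 1)" "?A *\<^sub>v w = 0\<^sub>v (d - 1)"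
      then have "\<forall>i\<in>{1..d - 1}. w $ (i - 1) = 0"
        using indep[THEN spec, THEN mp, OF iffD1[OF kernel[OF w(1)] w(3)]] by simp
      then have "w = 0\<^sub>v (d - 1)" using w(1) unfolding shift by (auto simp: vec_eq_iff)
      then show False using w(2) by simp
    qed
  qed
qed

lemma indep_on_H_if_jacobian_nonzero:
  assumes "meval (jacobian d n) (coord y) \<noteq> 0"
  shows "indep_on_H d {1..d - 1} (\<lambda>i. differential d (fpoly d n i) y)"
  using assms dual_vector_in_H unfolding jacobian_nonzero_iff indep_on_H_def by blast

lemma indep_on_H_mono:
  assumes "indep_on_H d I L" "finite I" "J \<subseteq> I"
  shows "indep_on_H d J L"
  unfolding indep_on_H_def
proof (intro allI impI)
  fix c assume c: "\<forall>v\<in>H d. (\<Sum>i\<in>J. c i * L i v) = 0"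
  define c' where "c' i = (if i \<in> J then c i else 0)" for i
  have "(\<Sum>i\<in>I. c' i * L i v) = (\<Sum>i\<in>J. c i * L i v)" for v
    using assms(2,3) by (intro sum.mono_neutral_cong_right) (auto simp: c'_def)
  then have "\<forall>i\<in>I. c' i = 0" using assms(1) c unfolding indep_on_H_def by simp
  then show "\<forall>i\<in>J. c i = 0" using assms(3) by (auto simp: c'_def split: if_splits)
qed

lemma indep_on_H_nonzero:
  assumes "indep_on_H d I L" "finite I" "i \<in> I"
  shows "\<exists>v\<in>H d. L i v \<noteq> 0"
proof (rule ccontr)
  assume "\<not> ?thesis"
  moreover have "indep_on_H d {i} L" using indep_on_H_mono[OF assms(1,2)] assms(3) by simp
  ultimately show False unfolding indep_on_H_def by (auto dest: spec[of _ "\<lambda>_. 1"])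
qed

text \<open>At a common point the matrix is congruent to the identity modulo the maximal ideal. A vector \<open>c\<close>
  in its kernel therefore vanishes: in the row of the largest entry \<open>c j\<close>, the relation expresses \<open>c j\<close>
  as a sum of strictly smaller terms.\<close>

lemma (in residue_char_valuation_ring) jacobian_nonzero:
  fixes x :: "'a pt"
  assumes d: "d = p ^ e" "0 < e" and n: "\<And>i. i \<in> {1..d - 1} \<Longrightarrow> 1 \<le> n i"
    and x: "x \<in> Vall d n"
  shows "meval (jacobian d n) (coord x) \<noteq> 0"
  unfolding jacobian_nonzero_iff
proof (intro allI impI)
  fix c
  assume c: "\<forall>j\<in>{1..d - 1}.
    (\<Sum>i\<in>{1..d - 1}. c i * differential d (fpoly d n i) x (dual_vector d j)) = 0"
  show "\<forall>i\<in>{1..d - 1}. c i = 0"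
  proof (cases "{1..d - 1} = {}")
    case False
    obtain a b where ab: "x = (a, b)" by (cases x)
    have xV: "(a, b) \<in> V d n i" if "i \<in> {1..d - 1}" for i
      using x that unfolding Vall_def ab by blast
    then have mean: "amean id d a = 0"
      using False by (auto simp: V_def H_def)
    have "(critF id d a b ^^ n i) (a i) = a i" if "i \<in> {1..d - 1}" for i
      using xV[OF that] by (simp add: V_def orbit_eq_def)
    then have int: "b \<preceq> 1 \<and> (\<forall>i\<in>{1..d - 1}. a i \<preceq> 1)"
      using n by (intro periodic_critical_points_integral[OF d mean, where n = n])
    have x_int: "coord x j \<preceq> 1" if "j < d" for j
      using int that by (auto simp: coord_def ab)
    have inv: "1 / of_nat (d - 1) \<preceq> (1 :: 'a)"
      using one_le_prime_power_minus_1[OF d(2)] unfolding d(1) by (rule inverse_le_one)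
    have near_identity: "(if i = j then 1 else 0) - differential d (fpoly d n i) x (dual_vector d j) \<prec> 1"
      if i: "i \<in> {1..d - 1}" and j: "j \<in> {1..d - 1}" for i j
    proof -
      have "coord (dual_vector d j) k \<preceq> (1 :: 'a)" if "k < d" for k
        using j that inv by (subst coord_dual_vector) (auto intro!: diff_le)
      then have "differential d (fpoly d n i) x (dual_vector d j)
          - (coord (dual_vector d j) i - coord (dual_vector d j) 0) \<prec> 1"
        by (intro differential_fpoly[where e = e] d x_int i n) 
      moreover have "coord (dual_vector d j) i - coord (dual_vector d j) 0 = (if i = j then 1 else 0 :: 'a)"
        using i j by (subst (1 2) coord_dual_vector) auto
      ultimately show ?thesis
        using minus_less_iff[of 1 "differential d (fpoly d n i) x (dual_vector d j) - (if i = j then 1 else 0)"]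
        by simp
    qed
    obtain j where j: "j \<in> {1..d - 1}" and max: "\<forall>i\<in>{1..d - 1}. c i \<preceq> c j"
      using exists_maximal[of "{1..d - 1}" c] False by auto
    have "c j = 0"
    proof (rule ccontr)
      assume cj: "c j \<noteq> 0"
      have "(\<Sum>i\<in>{1..d - 1}. c i * ((if i = j then 1 else 0)
          - differential d (fpoly d n i) x (dual_vector d j))) \<prec> c j"
      proof (rule sum_less[OF cj])
        fix i assume i: "i \<in> {1..d - 1}"
        show "c i * ((if i = j then 1 else 0) - differential d (fpoly d n i) x (dual_vector d j)) \<prec> c j"
          using mult_less[OF near_identity[OF i j] max[rule_format, OF i] cj] by (simp add: mult.commute)
      qed
      moreover have "(\<Sum>i\<in>{1..d - 1}. c i * ((if i = j then 1 else 0)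
          - differential d (fpoly d n i) x (dual_vector d j)))
          = (\<Sum>i\<in>{1..d - 1}. if i = j then c i else 0)
            - (\<Sum>i\<in>{1..d - 1}. c i * differential d (fpoly d n i) x (dual_vector d j))"
        unfolding sum_subtractf[symmetric]
        by (intro sum.cong refl) (simp add: right_diff_distrib)
      moreover have "\<dots> = c j" using c j by simp
      ultimately show False by simp
    qed
    then show ?thesis using max by simp
  qed simp
qed

theorem corollary2:
  fixes d :: nat and n :: "nat \<Rightarrow> nat" and x :: "(nat \<Rightarrow> 'a::field_char_0) \<times> 'a"
  assumes "d \<ge> 2" and "primepow d"
    and "\<And>i. i \<in> {1..d - 1} \<Longrightarrow> n i \<ge> 1"
    and "x \<in> Vall d n"
  shows "indep_on_H d {1..d - 1} (\<lambda>i. differential d (fpoly d n i) x)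
    \<and> (\<exists>g. x \<in> basic_open d g
        \<and> (\<forall>i\<in>{1..d - 1}. \<forall>y \<in> V d n i \<inter> basic_open d g.
              \<exists>v\<in>H d. differential d (fpoly d n i) y v \<noteq> 0)
        \<and> (\<forall>i\<in>{1..d - 1}. \<forall>j\<in>{1..d - 1}. i \<noteq> j \<longrightarrow>
              (\<forall>y \<in> V d n i \<inter> V d n j \<inter> basic_open d g.
                 indep_on_H d {i, j} (\<lambda>k. differential d (fpoly d n k) y))))"
proof -
  obtain p e where p: "prime p" and e: "0 < e" "d = p ^ e"
    using assms(2) by (auto simp: primepow_def)
  obtain R :: "'a set" where "residue_char_valuation_ring R p"
    using exists_residue_char_valuation_ring[OF p] by blast
  then have jac: "meval (jacobian d n) (coord x) \<noteq> 0"
    using residue_char_valuation_ring.jacobian_nonzero e assms(3,4) by blast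
  have "x \<in> V d n 1"
    using assms(1,4) by (auto simp: Vall_def)
  then have "x \<in> H d" by (auto simp: V_def)
  then have x: "x \<in> basic_open d (jacobian d n)"
    using jac by (simp add: basic_open_def)
  have indep: "indep_on_H d {1..d - 1} (\<lambda>i. differential d (fpoly d n i) y)"
    if "y \<in> basic_open d (jacobian d n)" for y
    using that by (intro indep_on_H_if_jacobian_nonzero) (simp add: basic_open_def)
  show ?thesis
  proof (intro conjI exI[of _ "jacobian d n"] ballI impI)
    fix i y assume "i \<in> {1..d - 1}" "y \<in> V d n i \<inter> basic_open d (jacobian d n)"
    then show "\<exists>v\<in>H d. differential d (fpoly d n i) y v \<noteq> 0"
      using indep_on_H_nonzero[OF indep, of y i] by simp
  next
    fix i j y
    assume "i \<in> {1..d - 1}" "j \<in> {1..d - 1}"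
      and "y \<in> V d n i \<inter> V d n j \<inter> basic_open d (jacobian d n)"
    then show "indep_on_H d {i, j} (\<lambda>k. differential d (fpoly d n k) y)"
      using indep_on_H_mono[OF indep, of y "{i, j}"] by simp
  qed (rule indep[OF x] x)+
qed

end
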